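(* Let $\mathcal{A}\in\mathbb{C}^{n_1\times n_2\times n_3}$ and let $\mathcal{A}=\mathcal{Q}*_c\mathcal{R}$ be the C-QR decomposition of $\mathcal{A}$. Then $$\mathcal{A}^\dagger=\mathcal{R}^\dagger*_c\mathcal{Q}^H.$$
   Context: For a third-order tensor $\mathcal{A}\in\mathbb{C}^{n_1\times n_2\times n_3}$, $\mathcal{A}^{(i)}=\mathcal{A}(:,:,i)\in\mathbb{C}^{n_1\times n_2}$ denotes its $i$-th frontal slice. Let $\mathbf{C}_{n_3}$ be the $n_3\times n_3$ orthogonal DCT matrix, with entries $(\mathbf{C}_{n_3})_{jk}=\sqrt{(2-\delta_{j1})/n_3}\,\cos\big(\tfrac{(j-1)(2k-1)\pi}{2n_3}\big)$; let $\mathbf{W}$ be the diagonal matrix whose diagonal is the first column of $\mathbf{C}_{n_3}$; let $\mathbf{Z}$ be the $n_3\times n_3$ matrix with ones on the first superdiagonal and zeros elsewhere; and put $\mathbf{M}=\mathbf{W}^{-1}\mathbf{C}_{n_3}(\mathbf{I}+\mathbf{Z})$, an invertible matrix. Define the linear bijection $L$ on tensors with third dimension $n_3$ by $L(\mathcal{A})_{ijk}=\sum_{l=1}^{n_3}\mathbf{M}_{kl}\mathcal{A}_{ijl}$. The C-product of $\mathcal{A}\in\mathbb{C}^{n_1\times n_2\times n_3}$ and $\mathcal{B}\in\mathbb{C}^{n_2\times l\times n_3}$ is the tensor $\mathcal{A}*_c\mathcal{B}\in\mathbb{C}^{n_1\times l\times n_3}$ determined by $L(\mathcal{A}*_c\mathcal{B})^{(i)}=L(\mathcal{A})^{(i)}L(\mathcal{B})^{(i)}$,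 $i=1,\dots,n_3$. The conjugate transpose $\mathcal{A}^H$ is determined by $L(\mathcal{A}^H)^{(i)}=(L(\mathcal{A})^{(i)})^H$ for all $i$. The identity tensor $\mathcal{I}\in\mathbb{C}^{n\times n\times n_3}$ is determined by $L(\mathcal{I})^{(i)}=\mathbf{I}_n$ for all $i$. A tensor $\mathcal{Q}\in\mathbb{C}^{n\times n\times n_3}$ is unitary if $\mathcal{Q}^H*_c\mathcal{Q}=\mathcal{Q}*_c\mathcal{Q}^H=\mathcal{I}$. A tensor is F-upper if all its frontal slices are upper triangular matrices. A C-QR decomposition of $\mathcal{A}\in\mathbb{C}^{n_1\times n_2\times n_3}$ is a factorization $\mathcal{A}=\mathcal{Q}*_c\mathcal{R}$ with $\mathcal{Q}\in\mathbb{C}^{n_1\times n_1\times n_3}$ unitary and $\mathcal{R}\in\mathbb{C}^{n_1\times n_2\times n_3}$ F-upper. The Moore-Penrose inverse $\mathcal{A}^\dagger$ is the (unique) tensor $\mathcal{X}\in\mathbb{C}^{n_2\times n_1\times n_3}$ with $\mathcal{A}*_c\mathcal{X}*_c\mathcal{A}=\mathcal{A}$, $\mathcal{X}*_c\mathcal{A}*_c\mathcal{X}=\mathcal{X}$, $(\mathcal{A}*_c\mathcal{X})^H=\mathcal{A}*_c\mathcal{X}$, $(\mathcal{X}*_c\mathcal{A})^H=\mathcal{X}*_c\mathcal{A}$. *)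

theory Defs
  imports
    Complex_Main
    "Jordan_Normal_Form.Schur_Decomposition"
    "Jordan_Normal_Form.Gauss_Jordan_Elimination"
begin

(* A third-order tensor is the vector of its frontal slices; all indices start at 0, so
   A $ k $$ (i,j) is the entry with 1-based indices (i+1, j+1, k+1). *)
type_synonym tensor = "complex mat vec"

definition carrier_tensor :: "nat \<Rightarrow> nat \<Rightarrow> nat \<Rightarrow> tensor set" where
  "carrier_tensor n1 n2 n3 =
     {A. dim_vec A = n3 \<and> (\<forall>k<n3. A $ k \<in> carrier_mat n1 n2)}"

definition dct_mat :: "nat \<Rightarrow> complex mat" where
  "dct_mat n = mat n n (\<lambda>(j,k). complex_of_real
     (sqrt ((if j = 0 then 1 else 2) / real n) * cos (real j * (2 * real k + 1) * pi / (2 * real n))))"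

definition W_mat :: "nat \<Rightarrow> complex mat" where
  "W_mat n = mat_diag n (\<lambda>i. dct_mat n $$ (i,0))"

definition Z_mat :: "nat \<Rightarrow> complex mat" where
  "Z_mat n = mat n n (\<lambda>(i,j). if j = i + 1 then 1 else 0)"

(* W_mat n is invertible, its diagonal entries being nonzero multiples of cos (i * pi / (2 * n))
   with i < n; hence mat_inverse does not return None here. *)
definition M_mat :: "nat \<Rightarrow> complex mat" where
  "M_mat n = the (mat_inverse (W_mat n)) * dct_mat n * (1\<^sub>m n + Z_mat n)"

definition L_op :: "tensor \<Rightarrow> tensor" where
  "L_op A = vec (dim_vec A) (\<lambda>k.
     mat (dim_row (A $ k)) (dim_col (A $ k))
       (\<lambda>(i,j). \<Sum>l<dim_vec A. M_mat (dim_vec A) $$ (k,l) * A $ l $$ (i,j)))"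

(* L_op keeps the number of slices and the dimensions of every slice, and it is a bijection on each
   carrier_tensor n1 n2 n3. So prescribing the slices of L_op C determines C, and the definite
   descriptions below are well defined without mentioning the dimensions of C. *)

definition cprod :: "tensor \<Rightarrow> tensor \<Rightarrow> tensor" (infixl "*\<^sub>c" 70) where
  "A *\<^sub>c B = (THE C. dim_vec C = dim_vec A \<and>
     (\<forall>i<dim_vec A. L_op C $ i
        = L_op A $ i * L_op B $ i))"

definition tensor_adjoint :: "tensor \<Rightarrow> tensor" where
  "tensor_adjoint A = (THE B. dim_vec B = dim_vec A \<and>
     (\<forall>i<dim_vec A. L_op B $ i = mat_adjoint (L_op A $ i)))"

definition id_tensor :: "nat \<Rightarrow> nat \<Rightarrow> tensor" where
  "id_tensor n n3 = (THE E. dim_vec E = n3 \<and>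
     (\<forall>i<n3. L_op E $ i = 1\<^sub>m n))"

definition unitary_tensor :: "nat \<Rightarrow> nat \<Rightarrow> tensor \<Rightarrow> bool" where
  "unitary_tensor n n3 Q \<longleftrightarrow> Q \<in> carrier_tensor n n n3 \<and>
     tensor_adjoint Q *\<^sub>c Q = id_tensor n n3 \<and> Q *\<^sub>c tensor_adjoint Q = id_tensor n n3"

(* The slices are rectangular. The predicate upper_triangular of the matrix library would, for a
   slice with more rows than columns, also constrain entries outside the matrix. *)
definition F_upper :: "tensor \<Rightarrow> bool" where
  "F_upper R \<longleftrightarrow> (\<forall>k<dim_vec R.
     \<forall>i<dim_row (R $ k). \<forall>j<dim_col (R $ k).
       j < i \<longrightarrow> R $ k $$ (i,j) = 0)"

definition is_CQR :: "nat \<Rightarrow> nat \<Rightarrow> nat \<Rightarrow> tensor \<Rightarrow> tensor \<Rightarrow> tensor \<Rightarrow> bool" where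
  "is_CQR n1 n2 n3 A Q R \<longleftrightarrow> unitary_tensor n1 n3 Q \<and>
     R \<in> carrier_tensor n1 n2 n3 \<and> F_upper R \<and> A = Q *\<^sub>c R"

definition is_MP_inverse :: "nat \<Rightarrow> nat \<Rightarrow> nat \<Rightarrow> tensor \<Rightarrow> tensor \<Rightarrow> bool" where
  "is_MP_inverse n1 n2 n3 A X \<longleftrightarrow> X \<in> carrier_tensor n2 n1 n3 \<and>
     A *\<^sub>c X *\<^sub>c A = A \<and> X *\<^sub>c A *\<^sub>c X = X \<and>
     tensor_adjoint (A *\<^sub>c X) = A *\<^sub>c X \<and> tensor_adjoint (X *\<^sub>c A) = X *\<^sub>c A"

definition MP_inverse :: "nat \<Rightarrow> nat \<Rightarrow> nat \<Rightarrow> tensor \<Rightarrow> tensor" where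
  "MP_inverse n1 n2 n3 A = (THE X. is_MP_inverse n1 n2 n3 A X)"

end

theory Submission
  imports Defs
begin

text \<open>
  The map \<open>L\<close> turns every tensor operation into the same operation on matrices, slice by slice:
  products into products, adjoints into adjoints, the identity tensor into identity matrices.
  So a tensor \<open>X\<close> satisfies the four Penrose equations for \<open>A\<close> exactly if every slice of \<open>L X\<close>
  satisfies them for the corresponding slice of \<open>L A\<close>
  (\<open>is_MP_inverse_iff_slices\<close>). For matrices, if \<open>Q\<close> is unitary and
  \<open>X\<close> is a Moore-Penrose inverse of \<open>R\<close>, then \<open>X Q\<^sup>H\<close> is one of \<open>Q R\<close>: in
  \<open>(Q R) (X Q\<^sup>H) = Q (R X) Q\<^sup>H\<close> and \<open>(X Q\<^sup>H) (Q R) = X R\<close> the factors \<open>Q\<^sup>H Q\<close>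
  cancel and the symmetry of \<open>R X\<close> and \<open>X R\<close> is inherited
  (\<open>moore_penrose_unitary_mult\<close>). As the Moore-Penrose inverse is unique, this is the claim.

  Two facts give this argument its meaning, since all the operations are definite descriptions.
  The first is that \<open>L\<close> is a bijection, that is, that \<open>M\<close> is invertible. Its three factors are:
  the inverse of a diagonal matrix whose entries are nonzero multiples of \<open>cos (i \<pi> / (2 n))\<close>
  with \<open>i < n\<close>, the cosine transform, whose rows are orthonormal by a telescoping sum, and a
  unitriangular matrix. The second is that
  every complex matrix has a Moore-Penrose inverse. Rank-one elimination gives some \<open>G\<close> with
  \<open>B G B = B\<close> for every matrix \<open>B\<close>; for \<open>B = A\<^sup>H A\<close>, the matrix \<open>G A\<^sup>H\<close> satisfies half
  of the Penrose equations for \<open>A\<close>. The same for \<open>A\<^sup>H\<close> gives the other half, and the two are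
  combined into one matrix.
\<close>

section \<open>The conjugate transpose of complex matrices\<close>

text \<open>Side conditions on dimensions, instead of carriers, let the simplifier use associativity on
  products of rectangular matrices.\<close>

lemma mult_mat_assoc_dim:
  "dim_col A = dim_row B \<Longrightarrow> dim_col B = dim_row C \<Longrightarrow> A * B * C = A * (B * C)"
  for A B C :: "'a::semiring_0 mat"
  by (rule assoc_mult_mat) auto

lemma mat_adjoint_dim [simp]:
  "dim_row (mat_adjoint A) = dim_col A" "dim_col (mat_adjoint A) = dim_row A"
  by (auto simp: mat_adjoint_def)

lemma mat_adjoint_carrier: "A \<in> carrier_mat m n \<Longrightarrow> mat_adjoint A \<in> carrier_mat n m"
  by auto

lemma mat_adjoint_index:
  "i < dim_col A \<Longrightarrow> j < dim_row A \<Longrightarrow> mat_adjoint A $$ (i,j) = conjugate (A $$ (j,i))"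
  by (simp add: mat_adjoint_def mat_of_rows_def)

lemma mat_adjoint_adjoint [simp]: "mat_adjoint (mat_adjoint A) = A"
  by (rule eq_matI) (auto simp: mat_adjoint_index)

lemma mat_adjoint_mult:
  assumes "dim_col A = dim_row B"
  shows "mat_adjoint (A * B) = mat_adjoint B * mat_adjoint (A :: complex mat)"
  by (rule eq_matI)
    (use assms in \<open>auto simp: mat_adjoint_index scalar_prod_def mult.commute intro!: sum.cong\<close>)

lemma adjoint_mult_self_eq_0:
  fixes D :: "complex mat"
  assumes "mat_adjoint D * D = 0\<^sub>m (dim_col D) (dim_col D)"
  shows "D = 0\<^sub>m (dim_row D) (dim_col D)"
proof (rule eq_matI)
  fix i j assume "i < dim_row (0\<^sub>m (dim_row D) (dim_col D))" "j < dim_col (0\<^sub>m (dim_row D) (dim_col D))"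
  then have i: "i < dim_row D" and j: "j < dim_col D" by auto
  have "(mat_adjoint D * D) $$ (j,j) = 0" using assms j by simp
  then have "(\<Sum>k<dim_row D. cnj (D $$ (k,j)) * D $$ (k,j)) = 0"
    using j by (simp add: scalar_prod_def mat_adjoint_index atLeast0LessThan)
  then have "complex_of_real (\<Sum>k<dim_row D. (cmod (D $$ (k,j)))\<^sup>2) = 0"
    by (simp only: of_real_sum complex_norm_square mult.commute)
  then have "(\<Sum>k<dim_row D. (cmod (D $$ (k,j)))\<^sup>2) = 0" by (simp only: of_real_eq_0_iff)
  then have "(cmod (D $$ (i,j)))\<^sup>2 = 0" using i by (subst (asm) sum_nonneg_eq_0_iff) auto
  then show "D $$ (i,j) = 0\<^sub>m (dim_row D) (dim_col D) $$ (i,j)" using i j by simp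
qed auto

lemma mat_minus_eq_0_imp_eq:
  fixes A B :: "complex mat"
  assumes A: "A \<in> carrier_mat m n" and B: "B \<in> carrier_mat m n" and "A - B = 0\<^sub>m m n"
  shows "A = B"
proof (rule eq_matI)
  fix i j assume "i < dim_row B" "j < dim_col B"
  then show "A $$ (i,j) = B $$ (i,j)" using arg_cong[OF assms(3), of "\<lambda>C. C $$ (i,j)"] A B by simp
qed (use A B in auto)

text \<open>The kernels of \<open>A\<^sup>H A\<close> and \<open>A\<close> agree: \<open>D = A (Y - Z)\<close> satisfies
  \<open>D\<^sup>H D = (Y - Z)\<^sup>H A\<^sup>H A (Y - Z)\<close>.\<close>

lemma adjoint_mult_cancel:
  fixes A :: "complex mat"
  assumes A: "A \<in> carrier_mat m n" and Y: "Y \<in> carrier_mat n l" and Z: "Z \<in> carrier_mat n l"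
    and eq: "mat_adjoint A * (A * Y) = mat_adjoint A * (A * Z)"
  shows "A * Y = A * Z"
proof -
  have A': "mat_adjoint A \<in> carrier_mat n m" using A by auto
  have AY: "A * Y \<in> carrier_mat m l" and AZ: "A * Z \<in> carrier_mat m l" using A Y Z by auto
  have YZ: "Y - Z \<in> carrier_mat n l" using Z by (rule minus_carrier_mat)
  define D where "D = A * (Y - Z)"
  have D: "D = A * Y - A * Z" unfolding D_def by (rule mult_minus_distrib_mat[OF A Y Z])
  have dim: "dim_row D = m" "dim_col D = l" using A YZ by (auto simp: D_def)
  have "mat_adjoint A * D = mat_adjoint A * (A * Y) - mat_adjoint A * (A * Z)"
    unfolding D by (rule mult_minus_distrib_mat[OF A' AY AZ])
  also have "\<dots> = 0\<^sub>m n l" using eq A Z by auto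
  finally have "mat_adjoint A * D = 0\<^sub>m n l" .
  moreover have "mat_adjoint D * D = mat_adjoint (Y - Z) * (mat_adjoint A * D)"
    using A Y Z dim by (subst D_def) (simp add: mat_adjoint_mult mult_mat_assoc_dim)
  ultimately have "mat_adjoint D * D = 0\<^sub>m l l"
    using right_mult_zero_mat[OF mat_adjoint_carrier[OF YZ], of l] by simp
  then have "D = 0\<^sub>m m l" using adjoint_mult_self_eq_0[of D] dim by simp
  then show ?thesis using mat_minus_eq_0_imp_eq[OF AY AZ] D by simp
qed

section \<open>Inner inverses by rank-one elimination\<close>

text \<open>An inner inverse of \<open>A - A C A\<close>, for any \<open>C\<close> at all, gives one of \<open>A\<close> (McCoy's lemma
  on von Neumann regular rings):
  \<open>A = (A - A C A) G (A - A C A) + A C A = A ((1 - C A) G (1 - A C) + C) A\<close>.\<close>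

lemma inner_inverse_step:
  fixes A :: "complex mat"
  assumes A: "A \<in> carrier_mat m n" and C: "C \<in> carrier_mat n m" and G: "G \<in> carrier_mat n m"
    and reg: "(A - A * C * A) * G * (A - A * C * A) = A - A * C * A"
  shows "\<exists>G\<in>carrier_mat n m. A * G * A = A"
proof -
  define P where "P = 1\<^sub>m n - C * A"
  define S where "S = 1\<^sub>m m - A * C"
  define B where "B = A - A * C * A"
  have P: "P \<in> carrier_mat n n" and S: "S \<in> carrier_mat m m" and B: "B \<in> carrier_mat m n"
    using A C by (auto simp: P_def S_def B_def intro!: minus_carrier_mat)
  have AP: "A * P = B"
    unfolding P_def B_def using A C
    by (subst mult_minus_distrib_mat[of _ m n]) (auto simp: mult_mat_assoc_dim)
  have SA: "S * A = B"
    unfolding S_def B_def using A C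
    by (subst minus_mult_distrib_mat[of _ m m]) auto
  define K where "K = P * (G * S) + C"
  have PGS: "P * (G * S) \<in> carrier_mat n m" using P G S by auto
  have K: "K \<in> carrier_mat n m" using C by (auto simp: K_def)
  have "A * K * A = A * (P * (G * S)) * A + A * C * A"
    unfolding K_def using A PGS C
    by (simp add: mult_add_distrib_mat[OF A PGS C] add_mult_distrib_mat[of _ m m _ _ n])
  also have "A * (P * (G * S)) * A = A * P * (G * (S * A))"
    using A P G S by (simp add: mult_mat_assoc_dim)
  also have "\<dots> = B * G * B"
    unfolding AP SA using B G by (simp add: mult_mat_assoc_dim)
  also have "\<dots> = B" using reg by (simp add: B_def)
  also have "B + A * C * A = A" using A C by (auto simp: B_def)
  finally show ?thesis using K by blast
qed

text \<open>If the entry of \<open>A\<close> at \<open>(p,q)\<close> is nonzero and \<open>C\<close> has its inverse at \<open>(q,p)\<close> as only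
  nonzero entry, then \<open>A - A C A\<close> is \<open>A\<close> after the elimination of row \<open>p\<close>, and its zero rows
  include those of \<open>A\<close>. So the number of nonzero rows decreases.\<close>

lemma inner_inverse_exists:
  fixes A :: "complex mat"
  assumes "A \<in> carrier_mat m n"
  shows "\<exists>G\<in>carrier_mat n m. A * G * A = A"
  using assms
proof (induction "card {i. i < m \<and> (\<exists>j<n. A $$ (i,j) \<noteq> 0)}" arbitrary: A rule: less_induct)
  case less
  note A = less.prems
  show ?case
  proof (cases "\<exists>p<m. \<exists>q<n. A $$ (p,q) \<noteq> 0")
    case False
    then have "A = 0\<^sub>m m n" using A by (intro eq_matI) auto
    then show ?thesis by (intro bexI[of _ "0\<^sub>m n m"]) auto
  next
    case True
    then obtain p q where p: "p < m" and q: "q < n" and pq: "A $$ (p,q) \<noteq> 0" by blast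
    define C where "C = mat n m (\<lambda>(i,j). if i = q \<and> j = p then 1 / A $$ (p,q) else 0)"
    have C: "C \<in> carrier_mat n m" by (simp add: C_def)
    define B where "B = A - A * C * A"
    have B: "B \<in> carrier_mat m n" using A by (auto simp: B_def intro!: minus_carrier_mat)
    have AC: "(A * C) $$ (i,k) = (if k = p then A $$ (i,q) / A $$ (p,q) else 0)"
      if "i < m" "k < m" for i k
      using that A q by (auto simp: C_def scalar_prod_def if_distrib[of "\<lambda>x. _ * x"] sum.delta cong: if_cong)
    have "(A * C * A) $$ (i,j) = A $$ (i,q) / A $$ (p,q) * A $$ (p,j)" if i: "i < m" and j: "j < n" for i j
    proof -
      have "(A * C * A) $$ (i,j) = (\<Sum>k\<in>{0..<m}. (A * C) $$ (i,k) * A $$ (k,j))"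
        using i j A C by (simp add: scalar_prod_def del: assoc_mult_mat)
      also have "\<dots> = (\<Sum>k\<in>{0..<m}. if k = p then A $$ (i,q) / A $$ (p,q) * A $$ (p,j) else 0)"
        using i by (intro sum.cong) (auto simp: AC)
      finally show ?thesis using p by simp
    qed
    then have B_entry: "B $$ (i,j) = A $$ (i,j) - A $$ (i,q) / A $$ (p,q) * A $$ (p,j)"
      if "i < m" "j < n" for i j
      using that A C by (simp add: B_def)
    have "{i. i < m \<and> (\<exists>j<n. B $$ (i,j) \<noteq> 0)} \<subset> {i. i < m \<and> (\<exists>j<n. A $$ (i,j) \<noteq> 0)}"
    proof (rule psubsetI)
      show "{i. i < m \<and> (\<exists>j<n. B $$ (i,j) \<noteq> 0)} \<subseteq> {i. i < m \<and> (\<exists>j<n. A $$ (i,j) \<noteq> 0)}"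
      proof clarify
        fix i j assume i: "i < m" and j: "j < n" and "B $$ (i,j) \<noteq> 0"
        then have "A $$ (i,j) \<noteq> 0 \<or> A $$ (i,q) \<noteq> 0" by (auto simp: B_entry)
        then show "\<exists>j<n. A $$ (i,j) \<noteq> 0" using j q by blast
      qed
      have "p \<notin> {i. i < m \<and> (\<exists>j<n. B $$ (i,j) \<noteq> 0)}" using p pq by (auto simp: B_entry)
      moreover have "p \<in> {i. i < m \<and> (\<exists>j<n. A $$ (i,j) \<noteq> 0)}" using p q pq by auto
      ultimately show "{i. i < m \<and> (\<exists>j<n. B $$ (i,j) \<noteq> 0)} \<noteq> {i. i < m \<and> (\<exists>j<n. A $$ (i,j) \<noteq> 0)}"
        by metis
    qed
    then have "card {i. i < m \<and> (\<exists>j<n. B $$ (i,j) \<noteq> 0)} < card {i. i < m \<and> (\<exists>j<n. A $$ (i,j) \<noteq> 0)}"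
      by (intro psubset_card_mono) auto
    from less.hyps[OF this B] obtain G where "G \<in> carrier_mat n m" "B * G * B = B" by blast
    then show ?thesis using inner_inverse_step[OF A C] by (simp add: B_def)
  qed
qed

section \<open>The Moore-Penrose inverse of a complex matrix\<close>

definition moore_penrose :: "complex mat \<Rightarrow> complex mat \<Rightarrow> bool" where
  "moore_penrose A X \<longleftrightarrow> X \<in> carrier_mat (dim_col A) (dim_row A) \<and>
     A * X * A = A \<and> X * A * X = X \<and>
     mat_adjoint (A * X) = A * X \<and> mat_adjoint (X * A) = X * A"

text \<open>With \<open>G\<close> an inner inverse of \<open>A\<^sup>H A\<close>, cancelling \<open>A\<^sup>H\<close> gives \<open>A G A\<^sup>H A = A\<close>, hence also
  \<open>A\<^sup>H A G\<^sup>H A\<^sup>H = A\<^sup>H\<close>. So \<open>A G A\<^sup>H = A G A\<^sup>H A G\<^sup>H A\<^sup>H = A G\<^sup>H A\<^sup>H\<close> is Hermitian.\<close>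

lemma hermitian_inner_inverse_exists:
  fixes A :: "complex mat"
  assumes A: "A \<in> carrier_mat m n"
  shows "\<exists>X\<in>carrier_mat n m. A * X * A = A \<and> mat_adjoint (A * X) = A * X"
proof -
  let ?A' = "mat_adjoint A"
  have A': "?A' \<in> carrier_mat n m" using A by auto
  have AA: "?A' * A \<in> carrier_mat n n" using A by auto
  from inner_inverse_exists[OF AA] obtain G
    where G: "G \<in> carrier_mat n n" and reg: "?A' * A * G * (?A' * A) = ?A' * A" by blast
  have "?A' * (A * (G * (?A' * A))) = ?A' * (A * 1\<^sub>m n)"
    using reg A G by (simp add: mult_mat_assoc_dim)
  moreover have "G * (?A' * A) \<in> carrier_mat n n" using G AA by auto
  ultimately have "A * (G * (?A' * A)) = A * 1\<^sub>m n" by (intro adjoint_mult_cancel[OF A]) auto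
  then have inner: "A * (G * (?A' * A)) = A" using A by simp
  from arg_cong[OF this, of mat_adjoint]
  have adj: "?A' * (A * (mat_adjoint G * ?A')) = ?A'"
    using A G by (simp add: mat_adjoint_mult mult_mat_assoc_dim)
  have "A * (G * ?A') = A * (G * (?A' * (A * (mat_adjoint G * ?A'))))" by (simp only: adj)
  also have "\<dots> = A * (G * (?A' * A)) * (mat_adjoint G * ?A')"
    using A G by (simp add: mult_mat_assoc_dim)
  also have "\<dots> = A * (mat_adjoint G * ?A')" by (simp only: inner)
  finally have herm: "A * (G * ?A') = A * (mat_adjoint G * ?A')" .
  show ?thesis
  proof (intro bexI conjI)
    show "A * (G * ?A') * A = A" using inner A G by (simp add: mult_mat_assoc_dim)
    show "mat_adjoint (A * (G * ?A')) = A * (G * ?A')"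
      using herm A G by (simp add: mat_adjoint_mult mult_mat_assoc_dim)
    show "G * ?A' \<in> carrier_mat n m" using G A by auto
  qed
qed

text \<open>If \<open>A X\<close> is Hermitian for one inner inverse \<open>X\<close> of \<open>A\<close> and \<open>Y A\<close> is Hermitian for
  another inner inverse \<open>Y\<close>, then \<open>T = Y A X\<close> satisfies \<open>A T = A X\<close> and
  \<open>T A = Y A\<close>, and so all four equations.\<close>

lemma moore_penrose_exists: "\<exists>X. moore_penrose A X"
proof -
  define m n where "m = dim_row A" and "n = dim_col A"
  have A: "A \<in> carrier_mat m n" by (auto simp: m_def n_def)
  obtain X where X: "X \<in> carrier_mat n m" and 1: "A * X * A = A" and 3: "mat_adjoint (A * X) = A * X"
    using hermitian_inner_inverse_exists[OF A] by blast
  obtain Z where Z: "Z \<in> carrier_mat m n" and 2: "mat_adjoint A * Z * mat_adjoint A = mat_adjoint A"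
    and 4: "mat_adjoint (mat_adjoint A * Z) = mat_adjoint A * Z"
    using hermitian_inner_inverse_exists[OF mat_adjoint_carrier[OF A]] by blast
  define Y where "Y = mat_adjoint Z"
  have Y: "Y \<in> carrier_mat n m" using Z by (auto simp: Y_def)
  have 5: "A * (Y * A) = A"
    using arg_cong[OF 2, of mat_adjoint] A Z
    by (simp add: mat_adjoint_mult mult_mat_assoc_dim Y_def)
  have 6: "mat_adjoint (Y * A) = Y * A"
    using 4 A Z by (simp add: mat_adjoint_mult Y_def)
  have 7: "A * (X * A) = A" using 1 A X by (simp add: mult_mat_assoc_dim)
  define T where "T = Y * (A * X)"
  have T: "T \<in> carrier_mat n m" using X Y A by (auto simp: T_def)
  have "A * T = A * (Y * A) * X" using A X Y by (simp add: T_def mult_mat_assoc_dim)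
  then have AT: "A * T = A * X" by (simp only: 5)
  have "T * A = Y * (A * (X * A))" using A X Y by (simp add: T_def mult_mat_assoc_dim)
  then have TA: "T * A = Y * A" by (simp only: 7)
  have "T * A * T = Y * (A * T)" unfolding TA using A Y T by (simp add: mult_mat_assoc_dim)
  also have "\<dots> = T" unfolding AT by (rule T_def[symmetric])
  finally have "T * A * T = T" .
  moreover have "A * T * A = A" unfolding AT by (rule 1)
  ultimately have "moore_penrose A T"
    unfolding moore_penrose_def using T AT TA 3 6 by (simp add: m_def n_def)
  then show ?thesis by blast
qed

text \<open>As \<open>A X = (A Y) (A X)\<close>, taking adjoints gives \<open>A X = (A X) (A Y) = A Y\<close>. Likewise
  \<open>X A = Y A\<close>, so that \<open>X = X A X = X A Y = Y A Y = Y\<close>.\<close>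

lemma moore_penrose_unique:
  assumes "moore_penrose A X" "moore_penrose A Y"
  shows "X = Y"
proof -
  note mp = assms[unfolded moore_penrose_def]
  have dim: "dim_row X = dim_col A" "dim_col X = dim_row A" "dim_row Y = dim_col A" "dim_col Y = dim_row A"
    using mp by auto
  note as = mult_mat_assoc_dim
  have "A * X = mat_adjoint (A * Y * A * X)" using mp by simp
  also have "\<dots> = mat_adjoint ((A * Y) * (A * X))" using dim by (simp add: as)
  also have "\<dots> = mat_adjoint (A * X) * mat_adjoint (A * Y)" using dim by (intro mat_adjoint_mult) simp
  also have "\<dots> = A * X * (A * Y)" using mp by simp
  also have "\<dots> = A * X * A * Y" using dim by (simp add: as)
  finally have AX: "A * X = A * Y" using mp by simp
  have "X * A = mat_adjoint (X * (A * Y * A))" using mp by simp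
  also have "\<dots> = mat_adjoint ((X * A) * (Y * A))" using dim by (simp add: as)
  also have "\<dots> = mat_adjoint (Y * A) * mat_adjoint (X * A)" using dim by (intro mat_adjoint_mult) simp
  also have "\<dots> = Y * A * (X * A)" using mp by simp
  also have "\<dots> = Y * (A * X * A)" using dim by (simp add: as)
  finally have XA: "X * A = Y * A" using mp by simp
  have "X = X * (A * X)" using mp dim by (simp add: as)
  also have "\<dots> = X * A * Y" unfolding AX using dim by (simp add: as)
  also have "\<dots> = Y" unfolding XA using mp by simp
  finally show ?thesis .
qed

lemma moore_penrose_unitary_mult:
  assumes Q: "Q \<in> carrier_mat m m" and U: "mat_adjoint Q * Q = 1\<^sub>m m"
    and R: "R \<in> carrier_mat m n" and X: "moore_penrose R X"
  shows "moore_penrose (Q * R) (X * mat_adjoint Q)"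
proof -
  let ?Q' = "mat_adjoint Q"
  note mp = X[unfolded moore_penrose_def]
  have Xc: "X \<in> carrier_mat n m" using mp R by auto
  have dim: "dim_row Q = m" "dim_col Q = m" "dim_row R = m" "dim_col R = n" "dim_row X = n" "dim_col X = m"
    using Q R Xc by auto
  note as = mult_mat_assoc_dim
  have QQ: "?Q' * (Q * B) = B" if "dim_row B = m" for B
  proof -
    have "?Q' * (Q * B) = ?Q' * Q * B" using that dim by (simp add: as)
    also have "\<dots> = B" unfolding U using that by (intro left_mult_one_mat) auto
    finally show ?thesis .
  qed
  have RXR: "R * (X * R) = R" and XRX: "X * (R * X) = X" using mp dim by (simp_all add: as)
  have XRX': "X * (R * (X * ?Q')) = X * ?Q'" using arg_cong[OF XRX, of "\<lambda>B. B * ?Q'"] dim by (simp add: as)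
  have left: "Q * R * (X * ?Q') = Q * (R * X) * ?Q'" using dim by (simp add: as)
  have right: "X * ?Q' * (Q * R) = X * R" using dim by (simp add: as QQ)
  have "mat_adjoint (Q * (R * X) * ?Q') = Q * (mat_adjoint (R * X) * ?Q')"
    using dim by (simp add: mat_adjoint_mult as)
  also have "\<dots> = Q * (R * X) * ?Q'" using mp dim by (simp add: as)
  finally have herm: "mat_adjoint (Q * (R * X) * ?Q') = Q * (R * X) * ?Q'" .
  show ?thesis unfolding moore_penrose_def
  proof (intro conjI)
    show "X * ?Q' \<in> carrier_mat (dim_col (Q * R)) (dim_row (Q * R))" using dim by auto
    show "Q * R * (X * ?Q') * (Q * R) = Q * R" using dim by (simp add: as QQ RXR)
    show "X * ?Q' * (Q * R) * (X * ?Q') = X * ?Q'" unfolding right using dim by (simp add: as XRX')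
    show "mat_adjoint (Q * R * (X * ?Q')) = Q * R * (X * ?Q')" unfolding left by (rule herm)
    show "mat_adjoint (X * ?Q' * (Q * R)) = X * ?Q' * (Q * R)" unfolding right using mp by simp
  qed
qed

section \<open>The transform matrix is invertible\<close>

text \<open>Multiplied by \<open>2 sin \<theta>\<close>, where \<open>\<theta> = m \<pi> / (2 n)\<close>, the sum telescopes to
  \<open>sin (2 n \<theta>) = sin (m \<pi>) = 0\<close>; and \<open>sin \<theta> \<noteq> 0\<close> because \<open>0 < \<theta> < \<pi>\<close>.\<close>

lemma sum_cos_odd_multiples_eq_0:
  fixes m n :: nat
  assumes "0 < m" "m < 2 * n"
  shows "(\<Sum>k<n. cos (real m * (2 * real k + 1) * pi / (2 * real n))) = 0"
proof -
  define t where "t = real m * pi / (2 * real n)"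
  have "0 < t" "t < pi" using assms by (auto simp: t_def field_simps)
  then have st: "sin t \<noteq> 0" using sin_gt_zero[of t] by simp
  have summand: "2 * sin t * cos (real m * (2 * real k + 1) * pi / (2 * real n))
      = sin (real (Suc k) * 2 * t) - sin (real k * 2 * t)" for k
  proof -
    have "real m * (2 * real k + 1) * pi / (2 * real n) = (2 * real k + 1) * t" by (simp add: t_def)
    moreover have "sin (real (Suc k) * 2 * t) = sin ((2 * real k + 1) * t + t)"
      "sin (real k * 2 * t) = sin ((2 * real k + 1) * t - t)"
      by (simp_all add: algebra_simps)
    ultimately show ?thesis by (simp only: sin_add sin_diff) simp
  qed
  have "2 * sin t * (\<Sum>k<n. cos (real m * (2 * real k + 1) * pi / (2 * real n)))
      = (\<Sum>k<n. sin (real (Suc k) * 2 * t) - sin (real k * 2 * t))"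
    unfolding sum_distrib_left by (simp only: summand)
  also have "\<dots> = sin (real n * 2 * t) - sin (real 0 * 2 * t)" by (rule sum_lessThan_telescope)
  also have "real n * 2 * t = real m * pi" using assms by (simp add: t_def)
  finally show ?thesis using st by simp
qed

text \<open>By \<open>2 cos x cos y = cos (x - y) + cos (x + y)\<close>, the inner product of the rows \<open>i\<close> and
  \<open>j \<le> i\<close> is the sum of two sums as above, for \<open>m = i - j\<close> and \<open>m = i + j\<close>. Each vanishes
  unless \<open>m = 0\<close>, when it is \<open>n\<close>. For \<open>i = j = 0\<close> both contribute, which is why row \<open>0\<close>
  is scaled differently.\<close>

lemma dct_rows_orthonormal:
  fixes i j n :: nat
  assumes i: "i < n" and j: "j < n"
  defines "c \<equiv> \<lambda>j. sqrt ((if j = 0 then 1 else 2) / real n)"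
    and "a \<equiv> \<lambda>j k. real j * (2 * real k + 1) * pi / (2 * real n)"
  shows "(\<Sum>k<n. (c i * cos (a i k)) * (c j * cos (a j k))) = (if i = j then 1 else 0)"
proof -
  have n: "real n > 0" using i by simp
  define s where "s m = (\<Sum>k<n. cos (real m * (2 * real k + 1) * pi / (2 * real n)))" for m :: nat
  have s0: "s 0 = real n" by (simp add: s_def)
  have s_pos: "s m = 0" if "0 < m" "m < 2 * n" for m
    using sum_cos_odd_multiples_eq_0[OF that] by (simp add: s_def)
  have prod: "(\<Sum>k<n. cos (a i k) * cos (a j k)) = (s (i - j) + s (i + j)) / 2" if "j \<le> i" for i j
  proof -
    have "cos (a i k) * cos (a j k) = (cos (real (i - j) * (2 * real k + 1) * pi / (2 * real n))
        + cos (real (i + j) * (2 * real k + 1) * pi / (2 * real n))) / 2" for k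
    proof -
      have "real (i - j) * (2 * real k + 1) * pi / (2 * real n) = a i k - a j k"
        "real (i + j) * (2 * real k + 1) * pi / (2 * real n) = a i k + a j k"
        using that n by (simp_all add: a_def of_nat_diff field_simps)
      then show ?thesis by (simp only: cos_times_cos)
    qed
    then show ?thesis unfolding s_def by (simp add: sum.distrib sum_divide_distrib add_divide_distrib)
  qed
  have ind: "(\<Sum>k<n. (c i * cos (a i k)) * (c j * cos (a j k))) = (if i = j then 1 else 0)"
    if ji: "j \<le> i" and i: "i < n" for i j
  proof -
    have "(\<Sum>k<n. (c i * cos (a i k)) * (c j * cos (a j k))) = c i * c j * (\<Sum>k<n. cos (a i k) * cos (a j k))"
      unfolding sum_distrib_left by (intro sum.cong) (auto simp: mult_ac)
    also have "\<dots> = c i * c j * ((s (i - j) + s (i + j)) / 2)" by (simp only: prod[OF ji])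
    also have "\<dots> = (if i = j then 1 else 0)"
    proof (cases "i = j")
      case True
      have "c i * c i = (if i = 0 then 1 else 2) / real n" using n by (simp add: c_def)
      then show ?thesis using True n i s0 s_pos[of "i + i"] by (cases "i = 0") auto
    next
      case False
      then show ?thesis using ji i s_pos[of "i - j"] s_pos[of "i + j"] by simp
    qed
    finally show ?thesis .
  qed
  show ?thesis
  proof (cases "j \<le> i")
    case True
    then show ?thesis using ind i by simp
  next
    case False
    then have "(\<Sum>k<n. (c j * cos (a j k)) * (c i * cos (a i k))) = (if j = i then 1 else 0)"
      using ind j by simp
    moreover have "(\<Sum>k<n. (c j * cos (a j k)) * (c i * cos (a i k)))
        = (\<Sum>k<n. (c i * cos (a i k)) * (c j * cos (a j k)))"
      by (intro sum.cong refl mult.commute)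
    ultimately show ?thesis by auto
  qed
qed

lemma dct_mat_mult_transpose: "dct_mat n * transpose_mat (dct_mat n) = 1\<^sub>m n"
proof (rule eq_matI)
  fix i j assume "i < dim_row (1\<^sub>m n)" "j < dim_col (1\<^sub>m n)"
  then have ij: "i < n" "j < n" by auto
  then have "(dct_mat n * transpose_mat (dct_mat n)) $$ (i,j) = complex_of_real (\<Sum>k<n.
     (sqrt ((if i = 0 then 1 else 2) / real n) * cos (real i * (2 * real k + 1) * pi / (2 * real n))) *
     (sqrt ((if j = 0 then 1 else 2) / real n) * cos (real j * (2 * real k + 1) * pi / (2 * real n))))"
    by (simp add: dct_mat_def scalar_prod_def atLeast0LessThan)
  also have "\<dots> = 1\<^sub>m n $$ (i,j)" unfolding dct_rows_orthonormal[OF ij] using ij by simp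
  finally show "(dct_mat n * transpose_mat (dct_mat n)) $$ (i,j) = 1\<^sub>m n $$ (i,j)" .
qed (auto simp: dct_mat_def)

lemma W_mat_diagonal_nonzero:
  assumes "i < n"
  shows "dct_mat n $$ (i,0) \<noteq> 0"
proof -
  have "0 \<le> real i * pi / (2 * real n)" "real i * pi / (2 * real n) < pi / 2"
    using assms by (auto simp: field_simps)
  then have "cos (real i * pi / (2 * real n)) > 0"
    using pi_gt_zero by (intro cos_gt_zero_pi) linarith+
  then show ?thesis using assms by (auto simp: dct_mat_def)
qed

lemma mat_inverse_W_mat:
  "the (mat_inverse (W_mat n)) \<in> carrier_mat n n"
  "W_mat n * the (mat_inverse (W_mat n)) = 1\<^sub>m n"
proof -
  have W: "W_mat n \<in> carrier_mat n n" by (simp add: W_mat_def)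
  define V where "V = mat_diag n (\<lambda>i. 1 / dct_mat n $$ (i,0))"
  have V: "V \<in> carrier_mat n n" by (simp add: V_def)
  have WV: "W_mat n * V = 1\<^sub>m n"
    unfolding W_mat_def V_def mat_diag_diag by (rule eq_matI) (auto simp: mat_diag_def W_mat_diagonal_nonzero)
  have VW: "V * W_mat n = 1\<^sub>m n" by (rule mat_mult_left_right_inverse[OF W V WV])
  have "W_mat n \<in> Units (ring_mat TYPE(complex) n undefined)"
    using W V WV VW by (auto simp: Units_def ring_mat_def intro!: bexI[of _ V])
  then obtain B where "mat_inverse (W_mat n) = Some B" using mat_inverse(1)[OF W] by fastforce
  then show "the (mat_inverse (W_mat n)) \<in> carrier_mat n n"
    "W_mat n * the (mat_inverse (W_mat n)) = 1\<^sub>m n"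
    using mat_inverse(2)[OF W] by auto
qed

lemma M_mat_carrier: "M_mat n \<in> carrier_mat n n"
  using mat_inverse_W_mat(1)[of n] by (auto simp: M_mat_def Z_mat_def)

lemma M_mat_invertible:
  obtains N where "N \<in> carrier_mat n n" "M_mat n * N = 1\<^sub>m n" "N * M_mat n = 1\<^sub>m n"
proof -
  let ?V = "the (mat_inverse (W_mat n))" and ?T = "1\<^sub>m n + Z_mat n"
  have V: "?V \<in> carrier_mat n n" by (rule mat_inverse_W_mat)
  have W: "W_mat n \<in> carrier_mat n n" by (simp add: W_mat_def)
  have C: "dct_mat n \<in> carrier_mat n n" by (simp add: dct_mat_def)
  have T: "?T \<in> carrier_mat n n" by (simp add: Z_mat_def)
  have "det (W_mat n) * det ?V = 1" using det_mult[OF W V] mat_inverse_W_mat(2)[of n] by simp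
  then have "det ?V \<noteq> 0" by auto
  moreover have "det (dct_mat n) * det (transpose_mat (dct_mat n)) = 1"
    using det_mult[OF C transpose_carrier_mat[THEN iffD2, OF C]] dct_mat_mult_transpose[of n] by simp
  then have "det (dct_mat n) \<noteq> 0" by auto
  moreover have "det ?T = prod_list (diag_mat ?T)"
    by (rule det_upper_triangular[OF _ T]) (auto simp: Z_mat_def)
  then have "det ?T \<noteq> 0" by (auto simp: prod_list_zero_iff diag_mat_def Z_mat_def)
  ultimately have "det (M_mat n) \<noteq> 0"
    unfolding M_mat_def using V C T by (simp add: det_mult[of _ n])
  from det_non_zero_imp_unit[OF M_mat_carrier this, of undefined]
  obtain N where "N \<in> carrier_mat n n" "M_mat n * N = 1\<^sub>m n" "N * M_mat n = 1\<^sub>m n"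
    by (auto simp: Units_def ring_mat_def)
  then show ?thesis by (rule that)
qed

section \<open>Tensors are determined by their transformed slices\<close>

lemma dim_vec_L_op [simp]: "dim_vec (L_op A) = dim_vec A"
  by (simp add: L_op_def)

lemma dim_L_op_slice:
  assumes "k < dim_vec A"
  shows "dim_row (L_op A $ k) = dim_row (A $ k)" "dim_col (L_op A $ k) = dim_col (A $ k)"
  using assms by (simp_all add: L_op_def)

lemma L_op_slice_carrier:
  "A \<in> carrier_tensor n1 n2 n3 \<Longrightarrow> k < n3 \<Longrightarrow> L_op A $ k \<in> carrier_mat n1 n2"
  by (intro carrier_matI) (auto simp: carrier_tensor_def dim_L_op_slice)

lemma L_op_entry:
  assumes "A \<in> carrier_tensor n1 n2 n3" "k < n3" "i < n1" "j < n2"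
  shows "L_op A $ k $$ (i,j) = (\<Sum>l<n3. M_mat n3 $$ (k,l) * A $ l $$ (i,j))"
  using assms by (auto simp: carrier_tensor_def L_op_def)

lemma inverse_mat_sum:
  fixes P P' :: "'a::comm_ring_1 mat"
  assumes P: "P \<in> carrier_mat n n" and P': "P' \<in> carrier_mat n n" and inv: "P * P' = 1\<^sub>m n" and k: "k < n"
  shows "(\<Sum>l<n. P $$ (k,l) * (\<Sum>k'<n. P' $$ (l,k') * b k')) = b k"
proof -
  have "(\<Sum>l<n. P $$ (k,l) * (\<Sum>k'<n. P' $$ (l,k') * b k'))
      = (\<Sum>k'<n. (\<Sum>l<n. P $$ (k,l) * P' $$ (l,k')) * b k')"
    unfolding sum_distrib_left sum_distrib_right by (subst sum.swap) (simp add: mult.assoc)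
  also have "\<dots> = (\<Sum>k'<n. (P * P') $$ (k,k') * b k')"
    using P P' k by (intro sum.cong) (auto simp: scalar_prod_def atLeast0LessThan)
  also have "\<dots> = (\<Sum>k'<n. if k' = k then b k' else 0)"
    unfolding inv using k by (intro sum.cong) auto
  finally show ?thesis using k by simp
qed

lemma L_op_inject:
  assumes A: "A \<in> carrier_tensor n1 n2 n3" and B: "B \<in> carrier_tensor n1 n2 n3"
    and eq: "\<And>k. k < n3 \<Longrightarrow> L_op A $ k = L_op B $ k"
  shows "A = B"
proof -
  obtain N where N: "N \<in> carrier_mat n3 n3" "N * M_mat n3 = 1\<^sub>m n3" by (rule M_mat_invertible)
  have rec: "C $ l $$ (i,j) = (\<Sum>k<n3. N $$ (l,k) * L_op C $ k $$ (i,j))"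
    if "C \<in> carrier_tensor n1 n2 n3" "l < n3" "i < n1" "j < n2" for C l i j
  proof -
    have "(\<Sum>k<n3. N $$ (l,k) * L_op C $ k $$ (i,j))
        = (\<Sum>k<n3. N $$ (l,k) * (\<Sum>l<n3. M_mat n3 $$ (k,l) * C $ l $$ (i,j)))"
      using that by (intro sum.cong) (auto simp: L_op_entry)
    also have "\<dots> = C $ l $$ (i,j)" by (rule inverse_mat_sum[OF N(1) M_mat_carrier N(2) that(2)])
    finally show ?thesis by simp
  qed
  have "A $ l = B $ l" if l: "l < n3" for l
  proof -
    have "A $ l \<in> carrier_mat n1 n2" "B $ l \<in> carrier_mat n1 n2"
      using A B l by (auto simp: carrier_tensor_def)
    then show ?thesis by (intro eq_matI) (auto simp: eq rec[OF A l] rec[OF B l])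
  qed
  then show ?thesis using A B by (intro eq_vecI) (auto simp: carrier_tensor_def)
qed

text \<open>The form in which the bijectivity of \<open>L\<close> is used: a family of slices of one fixed size
  is a valid definite description of a tensor.\<close>

lemma tensor_of_slices_ex1:
  assumes B: "\<And>k. k < n3 \<Longrightarrow> B k \<in> carrier_mat n1 n2"
  shows "\<exists>!C. dim_vec C = n3 \<and> (\<forall>k<n3. L_op C $ k = B k)"
proof -
  obtain N where N: "N \<in> carrier_mat n3 n3" "M_mat n3 * N = 1\<^sub>m n3" by (rule M_mat_invertible)
  define C where "C = vec n3 (\<lambda>l. mat n1 n2 (\<lambda>(i,j). \<Sum>k<n3. N $$ (l,k) * B k $$ (i,j)))"
  have C: "C \<in> carrier_tensor n1 n2 n3" by (simp add: C_def carrier_tensor_def)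
  have C_slices: "L_op C $ k = B k" if k: "k < n3" for k
  proof (rule eq_matI)
    fix i j assume "i < dim_row (B k)" "j < dim_col (B k)"
    then have ij: "i < n1" "j < n2" using B[OF k] by auto
    have "L_op C $ k $$ (i,j) = (\<Sum>l<n3. M_mat n3 $$ (k,l) * (\<Sum>k'<n3. N $$ (l,k') * B k' $$ (i,j)))"
      unfolding L_op_entry[OF C k ij] using ij by (intro sum.cong) (auto simp: C_def)
    also have "\<dots> = B k $$ (i,j)" by (rule inverse_mat_sum[OF M_mat_carrier N(1) N(2) k])
    finally show "L_op C $ k $$ (i,j) = B k $$ (i,j)" .
  qed (use B[OF k] L_op_slice_carrier[OF C k] in auto)
  show ?thesis
  proof (rule ex1I[of _ C])
    show "dim_vec C = n3 \<and> (\<forall>k<n3. L_op C $ k = B k)" using C C_slices by (simp add: carrier_tensor_def)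
    fix D :: tensor assume D: "dim_vec D = n3 \<and> (\<forall>k<n3. L_op D $ k = B k)"
    have "D $ k \<in> carrier_mat n1 n2" if "k < n3" for k
      using D B[OF that] dim_L_op_slice[of k D] that by (metis carrier_matD carrier_matI)
    then have "D \<in> carrier_tensor n1 n2 n3" using D by (simp add: carrier_tensor_def)
    then show "D = C" using D C C_slices by (intro L_op_inject[of _ n1 n2 n3]) auto
  qed
qed

lemma tensor_of_slices_the:
  assumes B: "\<And>k. k < n3 \<Longrightarrow> B k \<in> carrier_mat n1 n2"
  defines "C \<equiv> (THE C. dim_vec C = n3 \<and> (\<forall>k<n3. L_op C $ k = B k))"
  shows "C \<in> carrier_tensor n1 n2 n3" "k < n3 \<Longrightarrow> L_op C $ k = B k"
proof -
  have C: "dim_vec C = n3 \<and> (\<forall>k<n3. L_op C $ k = B k)"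
    unfolding C_def by (rule theI') (rule tensor_of_slices_ex1[OF B])
  then show "k < n3 \<Longrightarrow> L_op C $ k = B k" by blast
  have "C $ k \<in> carrier_mat n1 n2" if "k < n3" for k
    using C B[OF that] dim_L_op_slice[of k C] that by (metis carrier_matD carrier_matI)
  then show "C \<in> carrier_tensor n1 n2 n3" using C by (simp add: carrier_tensor_def)
qed

lemma cprod_slices:
  assumes A: "A \<in> carrier_tensor n1 n2 n3" and B: "B \<in> carrier_tensor n2 l n3"
  shows cprod_carrier: "A *\<^sub>c B \<in> carrier_tensor n1 l n3"
    and L_op_cprod: "k < n3 \<Longrightarrow> L_op (A *\<^sub>c B) $ k = L_op A $ k * L_op B $ k"
proof -
  have d: "dim_vec A = n3" using A by (simp add: carrier_tensor_def)
  have s: "L_op A $ k * L_op B $ k \<in> carrier_mat n1 l" if "k < n3" for k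
    using L_op_slice_carrier[OF A that] L_op_slice_carrier[OF B that] by simp
  show "A *\<^sub>c B \<in> carrier_tensor n1 l n3"
    "k < n3 \<Longrightarrow> L_op (A *\<^sub>c B) $ k = L_op A $ k * L_op B $ k"
    unfolding cprod_def d using tensor_of_slices_the[of n3 "\<lambda>k. L_op A $ k * L_op B $ k", OF s] by auto
qed

lemma tensor_adjoint_slices:
  assumes A: "A \<in> carrier_tensor n1 n2 n3"
  shows tensor_adjoint_carrier: "tensor_adjoint A \<in> carrier_tensor n2 n1 n3"
    and L_op_tensor_adjoint: "k < n3 \<Longrightarrow> L_op (tensor_adjoint A) $ k = mat_adjoint (L_op A $ k)"
proof -
  have d: "dim_vec A = n3" using A by (simp add: carrier_tensor_def)
  have s: "mat_adjoint (L_op A $ k) \<in> carrier_mat n2 n1" if "k < n3" for k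
    using L_op_slice_carrier[OF A that] by (rule mat_adjoint_carrier)
  show "tensor_adjoint A \<in> carrier_tensor n2 n1 n3"
    "k < n3 \<Longrightarrow> L_op (tensor_adjoint A) $ k = mat_adjoint (L_op A $ k)"
    unfolding tensor_adjoint_def d using tensor_of_slices_the[of n3 "\<lambda>k. mat_adjoint (L_op A $ k)", OF s] by auto
qed

lemma L_op_id_tensor: "k < n3 \<Longrightarrow> L_op (id_tensor n n3) $ k = 1\<^sub>m n"
  unfolding id_tensor_def by (rule tensor_of_slices_the(2)[of n3 "\<lambda>k. 1\<^sub>m n" n n]) auto

lemma tensor_eq_iff_slices:
  assumes "A \<in> carrier_tensor n1 n2 n3" "B \<in> carrier_tensor n1 n2 n3"
  shows "A = B \<longleftrightarrow> (\<forall>k<n3. L_op A $ k = L_op B $ k)"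
  using L_op_inject[OF assms] by auto

section \<open>The Moore-Penrose inverse of a tensor\<close>

lemma is_MP_inverse_iff_slices:
  assumes A: "A \<in> carrier_tensor n1 n2 n3" and X: "X \<in> carrier_tensor n2 n1 n3"
  shows "is_MP_inverse n1 n2 n3 A X \<longleftrightarrow> (\<forall>k<n3. moore_penrose (L_op A $ k) (L_op X $ k))"
proof -
  note AX = cprod_carrier[OF A X] and XA = cprod_carrier[OF X A]
  note eqs = tensor_eq_iff_slices[OF cprod_carrier[OF AX A] A]
    tensor_eq_iff_slices[OF cprod_carrier[OF XA X] X]
    tensor_eq_iff_slices[OF tensor_adjoint_carrier[OF AX] AX]
    tensor_eq_iff_slices[OF tensor_adjoint_carrier[OF XA] XA]
  have "L_op X $ k \<in> carrier_mat (dim_col (L_op A $ k)) (dim_row (L_op A $ k))" if "k < n3" for k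
    using L_op_slice_carrier[OF A that] L_op_slice_carrier[OF X that] by auto
  then show ?thesis
    unfolding is_MP_inverse_def moore_penrose_def eqs
    using X by (auto simp: L_op_cprod[OF AX A] L_op_cprod[OF XA X] L_op_cprod[OF A X] L_op_cprod[OF X A]
        L_op_tensor_adjoint[OF AX] L_op_tensor_adjoint[OF XA])
qed

lemma is_MP_inverse_unique:
  assumes A: "A \<in> carrier_tensor n1 n2 n3"
    and X: "is_MP_inverse n1 n2 n3 A X" and Y: "is_MP_inverse n1 n2 n3 A Y"
  shows "X = Y"
proof -
  have Xc: "X \<in> carrier_tensor n2 n1 n3" and Yc: "Y \<in> carrier_tensor n2 n1 n3"
    using X Y by (auto simp: is_MP_inverse_def)
  show ?thesis
    using X Y unfolding is_MP_inverse_iff_slices[OF A Xc] is_MP_inverse_iff_slices[OF A Yc]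
    by (intro L_op_inject[OF Xc Yc]) (auto intro: moore_penrose_unique)
qed

lemma is_MP_inverse_exists:
  assumes A: "A \<in> carrier_tensor n1 n2 n3"
  shows "\<exists>X. is_MP_inverse n1 n2 n3 A X"
proof -
  define B where "B k = (SOME X. moore_penrose (L_op A $ k) X)" for k
  have B: "moore_penrose (L_op A $ k) (B k)" for k
    unfolding B_def by (rule someI_ex) (rule moore_penrose_exists)
  have Bc: "B k \<in> carrier_mat n2 n1" if "k < n3" for k
    using B[of k] L_op_slice_carrier[OF A that] by (auto simp: moore_penrose_def)
  define X where "X = (THE C. dim_vec C = n3 \<and> (\<forall>k<n3. L_op C $ k = B k))"
  have "X \<in> carrier_tensor n2 n1 n3" "\<And>k. k < n3 \<Longrightarrow> L_op X $ k = B k"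
    unfolding X_def using tensor_of_slices_the[of n3 B, OF Bc] by auto
  then have "is_MP_inverse n1 n2 n3 A X" using is_MP_inverse_iff_slices[OF A, of X] B by simp
  then show ?thesis by blast
qed

lemma MP_inverse_equality:
  assumes "A \<in> carrier_tensor n1 n2 n3" "is_MP_inverse n1 n2 n3 A X"
  shows "MP_inverse n1 n2 n3 A = X"
  unfolding MP_inverse_def using assms is_MP_inverse_unique by blast

theorem theorem3p5:
  fixes n1 n2 n3 :: nat and A Q R :: tensor
  assumes "A \<in> carrier_tensor n1 n2 n3"
    and "is_CQR n1 n2 n3 A Q R"
  shows "MP_inverse n1 n2 n3 A = MP_inverse n1 n2 n3 R *\<^sub>c tensor_adjoint Q"
proof -
  have Q: "Q \<in> carrier_tensor n1 n1 n3" and R: "R \<in> carrier_tensor n1 n2 n3"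
    and U: "tensor_adjoint Q *\<^sub>c Q = id_tensor n1 n3" and AQR: "A = Q *\<^sub>c R"
    using assms(2) by (auto simp: is_CQR_def unitary_tensor_def)
  note Q' = tensor_adjoint_carrier[OF Q]
  obtain X where mp: "is_MP_inverse n1 n2 n3 R X" using is_MP_inverse_exists[OF R] by blast
  then have X: "X \<in> carrier_tensor n2 n1 n3" by (simp add: is_MP_inverse_def)
  have "moore_penrose (L_op A $ k) (L_op (X *\<^sub>c tensor_adjoint Q) $ k)" if k: "k < n3" for k
  proof -
    have "mat_adjoint (L_op Q $ k) * L_op Q $ k = 1\<^sub>m n1"
      using L_op_cprod[OF Q' Q k] by (simp add: U L_op_id_tensor[OF k] L_op_tensor_adjoint[OF Q k])
    moreover have "moore_penrose (L_op R $ k) (L_op X $ k)"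
      using mp k is_MP_inverse_iff_slices[OF R X] by blast
    ultimately show ?thesis
      unfolding AQR L_op_cprod[OF Q R k] L_op_cprod[OF X Q' k] L_op_tensor_adjoint[OF Q k]
      by (intro moore_penrose_unitary_mult[OF L_op_slice_carrier[OF Q k] _ L_op_slice_carrier[OF R k]])
  qed
  then have "is_MP_inverse n1 n2 n3 A (X *\<^sub>c tensor_adjoint Q)"
    using is_MP_inverse_iff_slices[OF assms(1) cprod_carrier[OF X Q']] by blast
  then show ?thesis
    using MP_inverse_equality[OF assms(1)] MP_inverse_equality[OF R mp] by simp
qed

end
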